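(* Let $\mathbf y_b\in\mathbb R^{n_b}$, $\mathbf X_b\in\mathbb R^{n_b\times m}$, $\mathbf V_b\in\mathbb R^{n_b\times n_b}$ symmetric positive definite, and $\mathbf A\in\mathbb R^{n\times n_b}$ of full column rank. Set $\mathbf y=\mathbf A\mathbf y_b$, $\mathbf X=\mathbf A\mathbf X_b$, $\mathbf V=\mathbf A\mathbf V_b\mathbf A^\top$, and define the projection-induced mappings $$\mathbf P_b=(\mathbf X_b^\top\mathbf V_b^{-1}\mathbf X_b)^{+}\mathbf X_b^\top\mathbf V_b^{-1}\in\mathbb R^{m\times n_b},\qquad \mathbf P=(\mathbf X^\top\mathbf V^{+}\mathbf X)^{+}\mathbf X^\top\mathbf V^{+}\in\mathbb R^{m\times n}.$$ Then $\mathbf P\mathbf A=\mathbf P_b$. In particular, for every row index $i$, writing $\mathbf p_i^\top$ and $\mathbf p_{b,i}^\top$ for the $i$-th rows of $\mathbf P$ and $\mathbf P_b$, one has $\mathbf p_{b,i}^\top=\mathbf p_i^\top\mathbf A$ and $\mathbf p_i^\top\mathbf y=\mathbf p_{b,i}^\top\mathbf y_b$. Moreover, if $\mathbf y_b=(\mathbf y_{b,1}^\top,\dots,\mathbf y_{b,K}^\top)^\top$ is partitioned into $K$ study blocks, $\mathbf V_b$ is block diagonal with respect to this partition, and $\mathbf A=\operatorname{diag}(\mathbf A_1,\dots,\mathbf A_K)$ is block diagonal with each $\mathbf A_k$ of full column rank, then for each study $k$ the corresponding blocks satisfy $\mathbf p_{b,i,k}^\top=\mathbf p_{i,k}^\top\mathbf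 A_k$ and $\mathbf p_{i,k}^\top\mathbf A_k\mathbf y_{b,k}=\mathbf p_{b,i,k}^\top\mathbf y_{b,k}$, i.e. each study-level contribution to the estimator is the same in both representations.
   Context: Notation as in network meta-analysis with observed contrasts $\mathbf y$, design matrix $\mathbf X$ and covariance $\mathbf V$; the GLS (network meta-analysis) estimator is $\hat{\boldsymbol\theta}=\mathbf P\mathbf y$ with $\mathbf P=(\mathbf X^\top\mathbf V^{+}\mathbf X)^{+}\mathbf X^\top\mathbf V^{+}$, where $^{+}$ denotes the Moore–Penrose pseudoinverse. The study-level contribution of study $k$ to the $i$-th estimated contrast is $\mathbf p_{i,k}^\top\mathbf y_k$, where $\mathbf p_{i,k}$ and $\mathbf y_k$ are the blocks of the $i$-th row of $\mathbf P$ and of $\mathbf y$ belonging to study $k$. The reduced representation $(\mathbf y_b,\mathbf X_b,\mathbf V_b)$ and the full representation $(\mathbf y,\mathbf X,\mathbf V)$ are related by the linear embedding $\mathbf A$ as stated. *)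

theory Defs
  imports "Jordan_Normal_Form.DL_Rank" "Jordan_Normal_Form.DL_Submatrix"
begin

text \<open>Moore--Penrose pseudoinverse of a real matrix: the unique matrix satisfying the
  four Penrose conditions.\<close>
definition pinv :: "real mat \<Rightarrow> real mat" where
  "pinv A = (THE B. B \<in> carrier_mat (dim_col A) (dim_row A) \<and>
       A * B * A = A \<and> B * A * B = B \<and>
       transpose_mat (A * B) = A * B \<and> transpose_mat (B * A) = B * A)"

text \<open>Ordinary inverse of a square (invertible) matrix.\<close>
definition inv_mat :: "real mat \<Rightarrow> real mat" where
  "inv_mat A = (THE B. B \<in> carrier_mat (dim_row A) (dim_row A) \<and> inverts_mat A B \<and> inverts_mat B A)"

text \<open>Symmetric positive definite n x n matrix.\<close>
definition sym_pos_def :: "nat \<Rightarrow> real mat \<Rightarrow> bool" where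
  "sym_pos_def n V \<longleftrightarrow> V \<in> carrier_mat n n \<and> transpose_mat V = V \<and>
     (\<forall>v \<in> carrier_vec n. v \<noteq> 0\<^sub>v n \<longrightarrow> v \<bullet> (V *\<^sub>v v) > 0)"

text \<open>Full column rank: the rank equals the number of columns.\<close>
definition full_col_rank :: "real mat \<Rightarrow> bool" where
  "full_col_rank A \<longleftrightarrow> vec_space.rank (dim_row A) A = dim_col A"

text \<open>The block of entries with indices in [a, b) of a vector.\<close>
definition subvec :: "'a vec \<Rightarrow> nat \<Rightarrow> nat \<Rightarrow> 'a vec" where
  "subvec v a b = vec (b - a) (\<lambda>j. v $ (a + j))"

end

theory Submission
  imports Defs
begin

(* A full-column-rank A has a left inverse L (L A = 1, A L symmetric), for instance
   L = (A^T A)^-1 A^T.  The Penrose conditions then identify the pseudoinverse of the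
   embedded covariance directly: (A Vb A^T)^+ = L^T Vb^-1 L.  Consequently
   X^T V^+ X = Xb^T Vb^-1 Xb and X^T V^+ A = Xb^T Vb^-1, which is P A = Pb.  Reading this
   identity row by row, and using that A maps the coordinates of study k only into the
   coordinates of study k, gives the row-level and study-level statements.  The outer
   pseudoinverse (Xb^T Vb^-1 Xb)^+ is never computed, but its dimensions are needed, and
   pinv is defined by a description; so the existence of Moore-Penrose inverses is proved
   as well, via a full-rank factorization. *)

(* Unlike assoc_mult_mat, only the inner dimension is constrained, so simp can discharge
   the side condition. *)
lemma assoc_mult_mat_dim:
  fixes A B C :: "'a :: comm_semiring_0 mat"
  assumes "dim_col B = dim_row C"
  shows "A * B * C = A * (B * C)"
proof (rule eq_matI)
  fix i j assume i: "i < dim_row (A * (B * C))" and j: "j < dim_col (A * (B * C))"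
  have "(A * B * C) $$ (i, j) =
      (\<Sum>k<dim_row C. (\<Sum>l<dim_row B. row A i $ l * B $$ (l, k)) * C $$ (k, j))"
    using i j assms by (simp add: scalar_prod_def atLeast0LessThan)
  also have "\<dots> = (\<Sum>l<dim_row B. row A i $ l * (\<Sum>k<dim_row C. B $$ (l, k) * C $$ (k, j)))"
    by (simp add: sum_distrib_left sum_distrib_right mult.assoc sum.swap[of _ "{..<dim_row C}"])
  also have "\<dots> = (A * (B * C)) $$ (i, j)"
    using i j assms by (simp add: scalar_prod_def atLeast0LessThan)
  finally show "(A * B * C) $$ (i, j) = (A * (B * C)) $$ (i, j)" .
qed auto

(* The premise dim_row X = k (rather than a carrier) makes this usable as a simp rule. *)
lemma left_inverse_mult_cancel:
  fixes L F X :: "'a :: semiring_1 mat"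
  assumes "L * F = 1\<^sub>m k" "L \<in> carrier_mat k r" "F \<in> carrier_mat r k" "dim_row X = k"
  shows "L * (F * X) = X"
proof -
  have X: "X \<in> carrier_mat k (dim_col X)" using assms(4) by auto
  have "L * (F * X) = L * F * X" using assoc_mult_mat[OF assms(2,3) X] by simp
  then show ?thesis using assms(1) left_mult_one_mat[OF X] by simp
qed

lemma zero_smult_vec [simp]: "(0 :: 'a :: semiring_0) \<cdot>\<^sub>v v = 0\<^sub>v (dim_vec v)"
  by (intro eq_vecI) auto

section \<open>Trivial kernels, inverses and left inverses\<close>

definition trivial_kernel :: "'a :: semiring_0 mat \<Rightarrow> bool" where
  "trivial_kernel M \<longleftrightarrow>
     (\<forall>v \<in> carrier_vec (dim_col M). M *\<^sub>v v = 0\<^sub>v (dim_row M) \<longrightarrow> v = 0\<^sub>v (dim_col M))"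

lemma trivial_kernelI:
  assumes "M \<in> carrier_mat r k"
    and "\<And>v. v \<in> carrier_vec k \<Longrightarrow> M *\<^sub>v v = 0\<^sub>v r \<Longrightarrow> v = 0\<^sub>v k"
  shows "trivial_kernel M"
  using assms unfolding trivial_kernel_def by auto

lemma trivial_kernelD:
  assumes "trivial_kernel M" "M \<in> carrier_mat r k" "v \<in> carrier_vec k" "M *\<^sub>v v = 0\<^sub>v r"
  shows "v = 0\<^sub>v k"
  using assms unfolding trivial_kernel_def by auto

lemma full_col_rank_imp_trivial_kernel:
  fixes A :: "real mat"
  assumes A: "A \<in> carrier_mat n k" and rank: "full_col_rank A"
  shows "trivial_kernel A"
proof (rule trivial_kernelI[OF A], rule ccontr)
  fix v assume v: "v \<in> carrier_vec k" and Av: "A *\<^sub>v v = 0\<^sub>v n" and nz: "v \<noteq> 0\<^sub>v k"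
  interpret vs: vec_space "TYPE(real)" n .
  have rk: "vs.rank A = k" using rank A unfolding full_col_rank_def by auto
  show False
  proof (cases "distinct (cols A)")
    case True
    then show False using vs.full_rank_lin_indpt[OF A rk] vs.lin_depI[OF A v nz Av] by simp
  next
    case False
    obtain S where S: "maximal S (\<lambda>T. T \<subseteq> set (cols A) \<and> vs.lin_indpt T)"
      using maximal_exists[of "\<lambda>T. T \<subseteq> set (cols A) \<and> vs.lin_indpt T" "card (set (cols A))" "{}"]
      by (meson List.finite_set card_mono empty_iff empty_subsetI vs.finite_lin_indpt2 rev_finite_subset)
    then have "card S \<le> card (set (cols A))" by (simp add: card_mono maximal_def)
    also have "\<dots> < k"
      using False A by (metis card_distinct card_length cols_length carrier_matD(2) nat_less_le)
    finally show False using vs.rank_card_indpt[OF A S] rk by simp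
  qed
qed

lemma sym_pos_def_imp_trivial_kernel:
  assumes "sym_pos_def n V"
  shows "trivial_kernel V"
  using assms unfolding sym_pos_def_def trivial_kernel_def by force

lemma trivial_kernel_gram:
  fixes F :: "real mat"
  assumes F: "F \<in> carrier_mat r k" and ker: "trivial_kernel F"
  shows "trivial_kernel (transpose_mat F * F)"
proof (rule trivial_kernelI)
  fix v assume v: "v \<in> carrier_vec k" and Gv: "(transpose_mat F * F) *\<^sub>v v = 0\<^sub>v k"
  have "(F *\<^sub>v v) \<bullet> (F *\<^sub>v v) = (transpose_mat F *\<^sub>v (F *\<^sub>v v)) \<bullet> v"
    using transpose_vec_mult_scalar[OF F v, of "F *\<^sub>v v"] F v by simp
  also have "\<dots> = 0" using Gv F v by simp
  finally have "F *\<^sub>v v = 0\<^sub>v r"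
    using conjugate_square_eq_0_vec[of "F *\<^sub>v v" r] F v by simp
  then show "v = 0\<^sub>v k" using trivial_kernelD[OF ker F v] by simp
qed (use F in simp)

lemma trivial_kernel_imp_inverse:
  fixes M :: "'a :: field mat"
  assumes M: "M \<in> carrier_mat k k" and ker: "trivial_kernel M"
  obtains Mi where "Mi \<in> carrier_mat k k" "M * Mi = 1\<^sub>m k" "Mi * M = 1\<^sub>m k"
proof -
  have "det M \<noteq> 0"
    using det_0_iff_vec_prod_zero_field[OF M] trivial_kernelD[OF ker M] by blast
  from det_non_zero_imp_unit[OF M this, of "()"] that show thesis
    unfolding Units_def ring_mat_def by auto
qed

lemma inv_mat_eqI:
  fixes M Mi :: "real mat"
  assumes M: "M \<in> carrier_mat k k" and Mi: "Mi \<in> carrier_mat k k"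
    and right: "M * Mi = 1\<^sub>m k" and left: "Mi * M = 1\<^sub>m k"
  shows "inv_mat M = Mi"
  unfolding inv_mat_def
proof (rule the_equality)
  show "Mi \<in> carrier_mat (dim_row M) (dim_row M) \<and> inverts_mat M Mi \<and> inverts_mat Mi M"
    using assms unfolding inverts_mat_def by simp
  fix B assume "B \<in> carrier_mat (dim_row M) (dim_row M) \<and> inverts_mat M B \<and> inverts_mat B M"
  then have B: "B \<in> carrier_mat k k" and BM: "B * M = 1\<^sub>m k"
    using M unfolding inverts_mat_def by auto
  have "B = B * (M * Mi)" using right B by simp
  also have "\<dots> = Mi" using BM B M Mi by (simp flip: assoc_mult_mat[OF B M Mi])
  finally show "B = Mi" .
qed

lemma symmetric_inverse:
  fixes M Mi :: "'a :: comm_ring_1 mat"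
  assumes M: "M \<in> carrier_mat k k" and Mi: "Mi \<in> carrier_mat k k"
    and sym: "transpose_mat M = M" and right: "M * Mi = 1\<^sub>m k" and left: "Mi * M = 1\<^sub>m k"
  shows "transpose_mat Mi = Mi"
proof -
  have "transpose_mat Mi = transpose_mat Mi * (M * Mi)" using right Mi by simp
  also have "\<dots> = transpose_mat (M * Mi) * Mi"
    using M Mi sym by (simp add: transpose_mult[OF M Mi])
  also have "\<dots> = Mi" using right Mi by simp
  finally show ?thesis .
qed

lemma trivial_kernel_left_inverse:
  fixes F :: "real mat"
  assumes F: "F \<in> carrier_mat r k" and ker: "trivial_kernel F"
  obtains L where "L \<in> carrier_mat k r" "L * F = 1\<^sub>m k" "transpose_mat (F * L) = F * L"
proof -
  have gram: "transpose_mat F * F \<in> carrier_mat k k" using F by simp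
  obtain Gi where Gi: "Gi \<in> carrier_mat k k"
    and right: "transpose_mat F * F * Gi = 1\<^sub>m k" and left: "Gi * (transpose_mat F * F) = 1\<^sub>m k"
    using trivial_kernel_imp_inverse[OF gram trivial_kernel_gram[OF F ker]] by blast
  have Gi_sym: "transpose_mat Gi = Gi"
    using symmetric_inverse[OF gram Gi _ right left] F by (simp add: transpose_mult[OF _ F])
  show thesis
  proof (rule that[of "Gi * transpose_mat F"])
    show "Gi * transpose_mat F * F = 1\<^sub>m k" using left Gi F by simp
    have "transpose_mat (F * (Gi * transpose_mat F)) =
        transpose_mat (Gi * transpose_mat F) * transpose_mat F"
      using transpose_mult[OF F, of "Gi * transpose_mat F" r] F Gi by simp
    also have "\<dots> = F * (Gi * transpose_mat F)"
      using F Gi Gi_sym by (simp add: transpose_mult[OF Gi])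
    finally show "transpose_mat (F * (Gi * transpose_mat F)) = F * (Gi * transpose_mat F)" .
  qed (use F Gi in simp)
qed

section \<open>The Moore-Penrose pseudoinverse\<close>

definition is_pinv :: "'a :: comm_semiring_0 mat \<Rightarrow> 'a mat \<Rightarrow> bool" where
  "is_pinv A B \<longleftrightarrow> B \<in> carrier_mat (dim_col A) (dim_row A) \<and>
     A * B * A = A \<and> B * A * B = B \<and>
     transpose_mat (A * B) = A * B \<and> transpose_mat (B * A) = B * A"

lemma is_pinv_unique:
  fixes A B C :: "'a :: comm_semiring_0 mat"
  assumes B: "is_pinv A B" and C: "is_pinv A C"
  shows "B = C"
proof -
  obtain r c where A: "A \<in> carrier_mat r c" by auto
  have Bc: "B \<in> carrier_mat c r" and Cc: "C \<in> carrier_mat c r"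
    using A B C unfolding is_pinv_def by auto
  have ABA: "A * B * A = A" and AB: "transpose_mat (A * B) = A * B"
    and BA: "transpose_mat (B * A) = B * A" and BAB: "B * A * B = B"
    using B unfolding is_pinv_def by auto
  have ACA: "A * C * A = A" and AC: "transpose_mat (A * C) = A * C"
    and CA: "transpose_mat (C * A) = C * A" and CAC: "C * A * C = C"
    using C unfolding is_pinv_def by auto
  have "A * B = transpose_mat (A * C * A * B)" using AB ACA by simp
  also have "\<dots> = transpose_mat ((A * C) * (A * B))"
    using A Bc Cc by (simp add: assoc_mult_mat_dim)
  also have "\<dots> = (A * B) * (A * C)"
    using AB AC A Bc Cc by (simp add: transpose_mult[of "A * C" r r "A * B" r])
  also have "\<dots> = A * B * A * C"
    using A Bc Cc by (simp add: assoc_mult_mat_dim)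
  finally have AB_AC: "A * B = A * C" using ABA by simp
  have "B * A = transpose_mat (B * (A * C * A))" using BA ACA by simp
  also have "\<dots> = transpose_mat ((B * A) * (C * A))"
    using A Bc Cc by (simp add: assoc_mult_mat_dim)
  also have "\<dots> = (C * A) * (B * A)"
    using BA CA A Bc Cc by (simp add: transpose_mult[of "B * A" c c "C * A" c])
  also have "\<dots> = C * (A * B * A)"
    using A Bc Cc by (simp add: assoc_mult_mat_dim)
  finally have BA_CA: "B * A = C * A" using ABA by simp
  have "B = B * A * B" using BAB by simp
  also have "\<dots> = C * A * C"
    using AB_AC BA_CA A Bc Cc by (simp add: assoc_mult_mat_dim)
  finally show ?thesis using CAC by simp
qed

lemma pinv_eqI:
  assumes "is_pinv A B"
  shows "pinv A = B"
  unfolding pinv_def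
proof (rule the_equality)
  show "B \<in> carrier_mat (dim_col A) (dim_row A) \<and> A * B * A = A \<and> B * A * B = B \<and>
      transpose_mat (A * B) = A * B \<and> transpose_mat (B * A) = B * A"
    using assms unfolding is_pinv_def .
qed (use is_pinv_unique[OF _ assms] in \<open>auto simp: is_pinv_def\<close>)

lemma is_pinv_mult:
  fixes F G L R :: "'a :: comm_semiring_1 mat"
  assumes F: "F \<in> carrier_mat r k" and G: "G \<in> carrier_mat k c"
    and L: "L \<in> carrier_mat k r" and R: "R \<in> carrier_mat c k"
    and LF: "L * F = 1\<^sub>m k" and GR: "G * R = 1\<^sub>m k"
    and FL: "transpose_mat (F * L) = F * L" and RG: "transpose_mat (R * G) = R * G"
  shows "is_pinv (F * G) (R * L)"
proof -
  note cancel = left_inverse_mult_cancel[OF LF L F] left_inverse_mult_cancel[OF GR G R]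
  have "F * G * (R * L) = F * L" and "R * L * (F * G) = R * G"
    using F G L R by (simp_all add: assoc_mult_mat_dim cancel)
  then show ?thesis
    unfolding is_pinv_def using F G L R FL RG by (simp add: assoc_mult_mat_dim cancel)
qed

lemma mult_mat_of_cols:
  assumes F: "F \<in> carrier_mat r k" and ws: "set ws \<subseteq> carrier_vec k"
  shows "F * mat_of_cols k ws = mat_of_cols r (map ((*\<^sub>v) F) ws)"
proof (rule eq_matI)
  fix i j assume i: "i < dim_row (mat_of_cols r (map ((*\<^sub>v) F) ws))"
    and j: "j < dim_col (mat_of_cols r (map ((*\<^sub>v) F) ws))"
  then have "ws ! j \<in> carrier_vec k" using ws by auto
  then show "(F * mat_of_cols k ws) $$ (i, j) = mat_of_cols r (map ((*\<^sub>v) F) ws) $$ (i, j)"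
    using F i j by (simp add: mat_of_cols_index)
qed (use F in auto)

lemma trivial_kernel_mat_of_rows_iff:
  assumes "set gs \<subseteq> carrier_vec k"
  shows "trivial_kernel (mat_of_rows k gs) \<longleftrightarrow>
    (\<forall>v \<in> carrier_vec k. (\<forall>g \<in> set gs. g \<bullet> v = 0) \<longrightarrow> v = 0\<^sub>v k)"
proof -
  have "gs ! i \<in> carrier_vec k" if "i < length gs" for i using assms that by auto
  then have "mat_of_rows k gs *\<^sub>v v = vec (length gs) (\<lambda>i. gs ! i \<bullet> v)" for v
    by (intro eq_vecI) auto
  then have "mat_of_rows k gs *\<^sub>v v = 0\<^sub>v (length gs) \<longleftrightarrow> (\<forall>g \<in> set gs. g \<bullet> v = 0)" for v
    by (simp add: vec_eq_iff all_set_conv_all_nth)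
  then show ?thesis unfolding trivial_kernel_def by simp
qed

lemma mat_of_cols_snoc_mult_append_vec:
  fixes F :: "'a :: comm_ring_1 mat"
  assumes F: "F \<in> carrier_mat r k" and a: "a \<in> carrier_vec r"
    and v: "v \<in> carrier_vec k" and x: "x \<in> carrier_vec 1"
  shows "mat_of_cols r (cols F @ [a]) *\<^sub>v (v @\<^sub>v x) = F *\<^sub>v v + x $ 0 \<cdot>\<^sub>v a"
proof (rule eq_vecI)
  fix i assume "i < dim_vec (F *\<^sub>v v + x $ 0 \<cdot>\<^sub>v a)"
  then have i: "i < r" using F a by simp
  have "(mat_of_cols r (cols F @ [a]) *\<^sub>v (v @\<^sub>v x)) $ i =
      (\<Sum>j<Suc k. mat_of_cols r (cols F @ [a]) $$ (i, j) * (v @\<^sub>v x) $ j)"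
    using i F v x by (simp add: scalar_prod_def atLeast0LessThan)
  also have "\<dots> = (\<Sum>j<k. F $$ (i, j) * v $ j) + a $ i * x $ 0"
    using i F v x by (simp add: mat_of_cols_index nth_append)
  also have "\<dots> = (F *\<^sub>v v + x $ 0 \<cdot>\<^sub>v a) $ i"
    using i F v a by (simp add: scalar_prod_def atLeast0LessThan mult.commute)
  finally show "(mat_of_cols r (cols F @ [a]) *\<^sub>v (v @\<^sub>v x)) $ i = (F *\<^sub>v v + x $ 0 \<cdot>\<^sub>v a) $ i" .
qed (use F a in simp)

lemma trivial_kernel_append_col:
  fixes F :: "'a :: field mat"
  assumes F: "F \<in> carrier_mat r k" and ker: "trivial_kernel F"
    and a: "a \<in> carrier_vec r" and new: "a \<notin> (*\<^sub>v) F ` carrier_vec k"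
  shows "trivial_kernel (mat_of_cols r (cols F @ [a]))"
proof (rule trivial_kernelI)
  fix z assume z: "z \<in> carrier_vec (length (cols F @ [a]))"
    and Fz: "mat_of_cols r (cols F @ [a]) *\<^sub>v z = 0\<^sub>v r"
  define v x where "v = vec_first z k" and "x = vec_last z 1"
  have z_eq: "z = v @\<^sub>v x" using z F unfolding v_def x_def by simp
  have v: "v \<in> carrier_vec k" and x: "x \<in> carrier_vec 1" unfolding v_def x_def by simp_all
  have Fvx: "F *\<^sub>v v + x $ 0 \<cdot>\<^sub>v a = 0\<^sub>v r"
    using Fz mat_of_cols_snoc_mult_append_vec[OF F a v x] unfolding z_eq by simp
  have x0: "x $ 0 = 0"
  proof (rule ccontr)
    assume nz: "x $ 0 \<noteq> 0"
    have "a = F *\<^sub>v (- (1 / x $ 0) \<cdot>\<^sub>v v)"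
    proof (rule eq_vecI)
      fix i assume "i < dim_vec (F *\<^sub>v (- (1 / x $ 0) \<cdot>\<^sub>v v))"
      then have i: "i < r" using F by simp
      have "(F *\<^sub>v v) $ i + x $ 0 * a $ i = 0"
        using arg_cong[OF Fvx, of "\<lambda>u. u $ i"] i F a by simp
      then have "a $ i = - (1 / x $ 0) * (F *\<^sub>v v) $ i"
        using nz by (simp add: field_simps add_eq_0_iff2)
      then show "a $ i = (F *\<^sub>v (- (1 / x $ 0) \<cdot>\<^sub>v v)) $ i"
        using i F v by (simp add: mult_mat_vec[OF F v])
    qed (use F a in simp)
    then show False using new v by auto
  qed
  then have "x = 0\<^sub>v 1" using x by (intro eq_vecI) auto
  moreover have "F *\<^sub>v v = 0\<^sub>v r" using Fvx F a v x0 by simp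
  then have "v = 0\<^sub>v k" using trivial_kernelD[OF ker F v] by simp
  ultimately show "z = 0\<^sub>v (length (cols F @ [a]))"
    using F unfolding z_eq by (intro eq_vecI) auto
qed (use mat_of_cols_carrier(1)[of r "cols F @ [a]"] in simp)

lemma trivial_kernel_mat_of_rows_extend:
  fixes gs :: "'a :: comm_ring_1 vec list"
  assumes gs: "set gs \<subseteq> carrier_vec k" and ker: "trivial_kernel (mat_of_rows k gs)"
  shows "trivial_kernel
    (mat_of_rows (k + 1) (map (\<lambda>g. g @\<^sub>v 0\<^sub>v 1) gs @ [0\<^sub>v k @\<^sub>v unit_vec 1 0]))"
proof -
  have gs': "set (map (\<lambda>g. g @\<^sub>v 0\<^sub>v 1) gs @ [0\<^sub>v k @\<^sub>v unit_vec 1 0]) \<subseteq> carrier_vec (k + 1)"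
    using gs by (auto intro!: append_carrier_vec[of _ k _ 1, simplified])
  show ?thesis unfolding trivial_kernel_mat_of_rows_iff[OF gs']
  proof (intro ballI impI)
    fix z assume z: "z \<in> carrier_vec (k + 1)"
      and orth: "\<forall>g \<in> set (map (\<lambda>g. g @\<^sub>v 0\<^sub>v 1) gs @ [0\<^sub>v k @\<^sub>v unit_vec 1 0]). g \<bullet> z = 0"
    define v x where "v = vec_first z k" and "x = vec_last z 1"
    have z_eq: "z = v @\<^sub>v x" using z unfolding v_def x_def by simp
    have v: "v \<in> carrier_vec k" and x: "x \<in> carrier_vec 1" unfolding v_def x_def by simp_all
    have "(0\<^sub>v k @\<^sub>v unit_vec 1 0) \<bullet> (v @\<^sub>v x) = 0" using orth z_eq by simp
    then have "x = 0\<^sub>v 1"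
      using v x scalar_prod_append[of "0\<^sub>v k" k "unit_vec 1 0" 1 v x]
      by (intro eq_vecI) auto
    moreover have "g \<bullet> v = 0" if g: "g \<in> set gs" for g
    proof -
      have "(g @\<^sub>v 0\<^sub>v 1) \<bullet> (v @\<^sub>v x) = 0" using orth z_eq g by simp
      then show ?thesis using g gs v x scalar_prod_append[of g k "0\<^sub>v 1" 1 v x] by auto
    qed
    then have "v = 0\<^sub>v k" using ker v unfolding trivial_kernel_mat_of_rows_iff[OF gs] by blast
    ultimately show "z = 0\<^sub>v (k + 1)" unfolding z_eq by (intro eq_vecI) auto
  qed
qed

(* Induction over the columns: a new column either lies in the range of F, and only the
   coefficient vectors grow, or it is appended to F, and every coefficient vector gets a
   new coordinate. *)
lemma cols_full_rank_factorization:
  fixes cs :: "'a :: field vec list"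
  assumes "set cs \<subseteq> carrier_vec r"
  shows "\<exists>k F gs. F \<in> carrier_mat r k \<and> trivial_kernel F \<and> set gs \<subseteq> carrier_vec k \<and>
    trivial_kernel (mat_of_rows k gs) \<and> cs = map ((*\<^sub>v) F) gs"
  using assms
proof (induction cs rule: rev_induct)
  case Nil
  have "trivial_kernel (0\<^sub>m r 0 :: 'a mat)" and "trivial_kernel (mat_of_rows 0 ([] :: 'a vec list))"
    by (rule trivial_kernelI, auto)+
  then show ?case by (intro exI[of _ 0] exI[of _ "0\<^sub>m r 0"] exI[of _ "[]"]) auto
next
  case (snoc a cs)
  then obtain k F gs where F: "F \<in> carrier_mat r k" "trivial_kernel F"
    and gs: "set gs \<subseteq> carrier_vec k" "trivial_kernel (mat_of_rows k gs)"
    and cs: "cs = map ((*\<^sub>v) F) gs" and a: "a \<in> carrier_vec r" by auto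
  show ?case
  proof (cases "a \<in> (*\<^sub>v) F ` carrier_vec k")
    case True
    then obtain w where w: "w \<in> carrier_vec k" "a = F *\<^sub>v w" by blast
    then have "trivial_kernel (mat_of_rows k (gs @ [w]))"
      using gs trivial_kernel_mat_of_rows_iff[of gs k] trivial_kernel_mat_of_rows_iff[of "gs @ [w]" k]
      by simp
    then show ?thesis
      using F gs(1) cs w by (intro exI[of _ k] exI[of _ F] exI[of _ "gs @ [w]"]) simp
  next
    case False
    define F' where "F' = mat_of_cols r (cols F @ [a])"
    define gs' where "gs' = map (\<lambda>g. g @\<^sub>v 0\<^sub>v 1) gs @ [0\<^sub>v k @\<^sub>v unit_vec 1 0]"
    have "F' \<in> carrier_mat r (k + 1)"
      using F mat_of_cols_carrier(1)[of r "cols F @ [a]"] unfolding F'_def by simp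
    moreover have "set gs' \<subseteq> carrier_vec (k + 1)"
      using gs unfolding gs'_def by (auto intro!: append_carrier_vec[of _ k _ 1, simplified])
    moreover have "cs @ [a] = map ((*\<^sub>v) F') gs'"
      using F a gs mat_of_cols_snoc_mult_append_vec[OF F(1) a] unfolding cs F'_def gs'_def by auto
    ultimately show ?thesis
      using trivial_kernel_append_col[OF F a False] trivial_kernel_mat_of_rows_extend[OF gs]
      unfolding F'_def gs'_def by blast
  qed
qed

lemma full_rank_factorization:
  fixes A :: "'a :: field mat"
  assumes A: "A \<in> carrier_mat r c"
  obtains k F G where "F \<in> carrier_mat r k" "G \<in> carrier_mat k c" "A = F * G"
    "trivial_kernel F" "trivial_kernel (transpose_mat G)"
proof -
  obtain k F gs where F: "F \<in> carrier_mat r k" "trivial_kernel F" and gs: "set gs \<subseteq> carrier_vec k"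
    and ker: "trivial_kernel (mat_of_rows k gs)" and cols: "cols A = map ((*\<^sub>v) F) gs"
    using cols_full_rank_factorization[of "cols A" r] A cols_dim[of A] by auto
  have "length gs = c" using arg_cong[OF cols, of length] A by simp
  moreover have "A = F * mat_of_cols k gs"
    using A mat_of_cols_cols[of A] mult_mat_of_cols[OF F(1) gs] cols by simp
  ultimately show thesis
    using F ker by (intro that[of F k "mat_of_cols k gs"]) (auto simp: transpose_mat_of_cols)
qed

lemma is_pinv_pinv:
  fixes A :: "real mat"
  shows "is_pinv A (pinv A)"
proof -
  obtain r c where "A \<in> carrier_mat r c" by auto
  then obtain k F G where F: "F \<in> carrier_mat r k" and G: "G \<in> carrier_mat k c"
    and AFG: "A = F * G" and ker: "trivial_kernel F" "trivial_kernel (transpose_mat G)"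
    by (rule full_rank_factorization)
  have GT: "transpose_mat G \<in> carrier_mat c k" using G by simp
  obtain L where L: "L \<in> carrier_mat k r" "L * F = 1\<^sub>m k" "transpose_mat (F * L) = F * L"
    using trivial_kernel_left_inverse[OF F ker(1)] by blast
  obtain L' where L': "L' \<in> carrier_mat k c" "L' * transpose_mat G = 1\<^sub>m k"
    "transpose_mat (transpose_mat G * L') = transpose_mat G * L'"
    using trivial_kernel_left_inverse[OF GT ker(2)] by blast
  have "G * transpose_mat L' = transpose_mat (L' * transpose_mat G)"
    using transpose_mult[OF L'(1) GT] by simp
  also have "\<dots> = 1\<^sub>m k" using L'(2) by simp
  finally have right_inv: "G * transpose_mat L' = 1\<^sub>m k" .
  have sym: "transpose_mat L' * G = transpose_mat (transpose_mat G * L')"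
    using transpose_mult[OF GT L'(1)] by simp
  have "is_pinv (F * G) (transpose_mat L' * L)"
    using L'(3) sym
    by (intro is_pinv_mult[OF F G L(1) _ L(2) right_inv L(3)]) (use L'(1) in simp_all)
  then show ?thesis using pinv_eqI AFG by simp
qed

lemma pinv_carrier_mat: "pinv A \<in> carrier_mat (dim_col A) (dim_row A)"
  using is_pinv_pinv[of A] unfolding is_pinv_def by blast

lemma pinv_congruence:
  fixes A L M Mi :: "real mat"
  assumes A: "A \<in> carrier_mat n k" and L: "L \<in> carrier_mat k n"
    and LA: "L * A = 1\<^sub>m k" and AL: "transpose_mat (A * L) = A * L"
    and M: "M \<in> carrier_mat k k" and Mi: "Mi \<in> carrier_mat k k"
    and MMi: "M * Mi = 1\<^sub>m k" and MiM: "Mi * M = 1\<^sub>m k"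
  shows "pinv (A * M * transpose_mat A) = transpose_mat L * Mi * L"
proof (rule pinv_eqI)
  have AT: "transpose_mat A \<in> carrier_mat k n" and LT: "transpose_mat L \<in> carrier_mat n k"
    using A L by simp_all
  have ATLT: "transpose_mat A * transpose_mat L = 1\<^sub>m k"
    using arg_cong[OF LA, of transpose_mat] transpose_mult[OF L A] by simp
  note cancel = left_inverse_mult_cancel[OF LA L A] left_inverse_mult_cancel[OF ATLT AT LT]
    left_inverse_mult_cancel[OF MMi M Mi] left_inverse_mult_cancel[OF MiM Mi M]
  have SB: "A * M * transpose_mat A * (transpose_mat L * Mi * L) = A * L"
    using A L M Mi by (simp add: assoc_mult_mat_dim cancel)
  have BS: "transpose_mat L * Mi * L * (A * M * transpose_mat A) = transpose_mat L * transpose_mat A"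
    using A L M Mi by (simp add: assoc_mult_mat_dim cancel)
  have LTAT: "transpose_mat L * transpose_mat A = A * L" using AL transpose_mult[OF A L] by simp
  show "is_pinv (A * M * transpose_mat A) (transpose_mat L * Mi * L)"
    unfolding is_pinv_def
  proof (intro conjI)
    show "A * M * transpose_mat A * (transpose_mat L * Mi * L) * (A * M * transpose_mat A) =
        A * M * transpose_mat A"
      unfolding SB using A L M Mi by (simp add: assoc_mult_mat_dim cancel)
    show "transpose_mat L * Mi * L * (A * M * transpose_mat A) * (transpose_mat L * Mi * L) =
        transpose_mat L * Mi * L"
      unfolding BS using A L M Mi by (simp add: assoc_mult_mat_dim cancel)
    show "transpose_mat (A * M * transpose_mat A * (transpose_mat L * Mi * L)) =
        A * M * transpose_mat A * (transpose_mat L * Mi * L)"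
      unfolding SB by (rule AL)
    show "transpose_mat (transpose_mat L * Mi * L * (A * M * transpose_mat A)) =
        transpose_mat L * Mi * L * (A * M * transpose_mat A)"
      unfolding BS LTAT by (rule AL)
  qed (use A L Mi in simp)
qed

section \<open>Generalised least squares under a linear embedding\<close>

(* The GLS estimator map with weight W: Pb is gls_projection Xb Vb^-1 and P is
   gls_projection X V^+. *)
definition gls_projection :: "real mat \<Rightarrow> real mat \<Rightarrow> real mat" where
  "gls_projection X W = pinv (transpose_mat X * W * X) * transpose_mat X * W"

lemma gls_projection_carrier_mat:
  assumes "X \<in> carrier_mat r m" and "W \<in> carrier_mat r r"
  shows "gls_projection X W \<in> carrier_mat m r"
proof -
  have "pinv (transpose_mat X * W * X) \<in> carrier_mat m m"
    using pinv_carrier_mat[of "transpose_mat X * W * X"] assms by simp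
  then show ?thesis
    unfolding gls_projection_def using assms by (meson mult_carrier_mat transpose_carrier_mat)
qed

lemma gls_projection_embedding:
  assumes A: "A \<in> carrier_mat n k" and X: "X \<in> carrier_mat k m"
    and L: "L \<in> carrier_mat k n" and LA: "L * A = 1\<^sub>m k" and W: "W \<in> carrier_mat k k"
  shows "gls_projection (A * X) (transpose_mat L * W * L) * A = gls_projection X W"
proof -
  have AT: "transpose_mat A \<in> carrier_mat k n" and LT: "transpose_mat L \<in> carrier_mat n k"
    using A L by simp_all
  have ATLT: "transpose_mat A * transpose_mat L = 1\<^sub>m k"
    using arg_cong[OF LA, of transpose_mat] transpose_mult[OF L A] by simp
  have WLA: "W * (L * A) = W" using LA W by simp
  note simps = assoc_mult_mat_dim left_inverse_mult_cancel[OF LA L A]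
    left_inverse_mult_cancel[OF ATLT AT LT] WLA transpose_mult[OF A X]
  have "transpose_mat (A * X) * (transpose_mat L * W * L) * (A * X) = transpose_mat X * W * X"
    using A X L W by (simp add: simps)
  then show ?thesis
    unfolding gls_projection_def using A X L W by (simp add: simps)
qed

lemma row_mult_eq_transpose_mult_vec:
  fixes P A :: "'a :: comm_semiring_0 mat"
  assumes P: "P \<in> carrier_mat m n" and A: "A \<in> carrier_mat n k" and i: "i < m"
  shows "row (P * A) i = transpose_mat A *\<^sub>v row P i"
proof (rule eq_vecI)
  fix j assume "j < dim_vec (transpose_mat A *\<^sub>v row P i)"
  then have j: "j < k" using A by simp
  have "row P i \<bullet> col A j = col A j \<bullet> row P i"
    by (rule comm_scalar_prod[of _ n]) (use P A i in auto)
  then show "row (P * A) i $ j = (transpose_mat A *\<^sub>v row P i) $ j" using P A i j by simp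
qed (use A in simp)

lemma row_scalar_prod_mult_mat_vec:
  fixes P A :: "'a :: comm_semiring_0 mat"
  assumes P: "P \<in> carrier_mat m n" and A: "A \<in> carrier_mat n k" and v: "v \<in> carrier_vec k"
    and i: "i < m"
  shows "row P i \<bullet> (A *\<^sub>v v) = row (P * A) i \<bullet> v"
  using transpose_vec_mult_scalar[OF A v, of "row P i"] row_mult_eq_transpose_mult_vec[OF P A i] P i
  by simp

section \<open>Block structure\<close>

lemma pick_atLeastLessThan:
  assumes "i < b - a"
  shows "pick {a..<b} i = a + i"
proof -
  have "{x \<in> {a..<b}. x < a + i} = {a..<a + i}" using assms by auto
  then show ?thesis using pick_card_in_set[of "a + i" "{a..<b}"] assms by simp
qed

lemma submatrix_atLeastLessThan:
  assumes "b \<le> dim_row A" and "d \<le> dim_col A"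
  shows "submatrix A {a..<b} {c..<d} = mat (b - a) (d - c) (\<lambda>(i, j). A $$ (a + i, c + j))"
proof -
  have "{i. i < dim_row A \<and> i \<in> {a..<b}} = {a..<b}" "{j. j < dim_col A \<and> j \<in> {c..<d}} = {c..<d}"
    using assms by auto
  then show ?thesis
    unfolding submatrix_def by (intro eq_matI) (auto simp: pick_atLeastLessThan)
qed

lemma subvec_row_mult_block:
  fixes P A :: "'a :: comm_semiring_0 mat"
  assumes P: "P \<in> carrier_mat m n" and A: "A \<in> carrier_mat n nb" and i: "i < m"
    and b: "b \<le> n" and b': "b' \<le> nb"
    and zero: "\<And>r j. r < n \<Longrightarrow> r \<notin> {a..<b} \<Longrightarrow> j \<in> {a'..<b'} \<Longrightarrow> A $$ (r, j) = 0"
  shows "subvec (row (P * A) i) a' b' =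
    transpose_mat (submatrix A {a..<b} {a'..<b'}) *\<^sub>v subvec (row P i) a b"
proof (rule eq_vecI)
  fix j assume "j < dim_vec (transpose_mat (submatrix A {a..<b} {a'..<b'}) *\<^sub>v subvec (row P i) a b)"
  then have j: "j < b' - a'" using A b b' by (simp add: submatrix_atLeastLessThan)
  have "subvec (row (P * A) i) a' b' $ j = (\<Sum>r<n. P $$ (i, r) * A $$ (r, a' + j))"
    using P A i j b' by (simp add: subvec_def scalar_prod_def atLeast0LessThan)
  also have "\<dots> = (\<Sum>r\<in>{a..<b}. P $$ (i, r) * A $$ (r, a' + j))"
    using zero j b by (intro sum.mono_neutral_right) auto
  also have "\<dots> = (\<Sum>l<b - a. P $$ (i, a + l) * A $$ (a + l, a' + j))"
  proof (cases "a \<le> b")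
    case True
    then show ?thesis
      using sum.shift_bounds_nat_ivl[of "\<lambda>r. P $$ (i, r) * A $$ (r, a' + j)" 0 a "b - a"]
      by (simp add: atLeast0LessThan add.commute)
  qed simp
  also have "\<dots> = (transpose_mat (submatrix A {a..<b} {a'..<b'}) *\<^sub>v subvec (row P i) a b) $ j"
    using P A i j b b' by (simp add: submatrix_atLeastLessThan subvec_def scalar_prod_def
        atLeast0LessThan mult.commute)
  finally show "subvec (row (P * A) i) a' b' $ j =
      (transpose_mat (submatrix A {a..<b} {a'..<b'}) *\<^sub>v subvec (row P i) a b) $ j" .
qed (use A b b' in \<open>simp add: subvec_def submatrix_atLeastLessThan\<close>)

lemma lift_Suc_mono_le_bounded:
  fixes f :: "nat \<Rightarrow> 'a :: order"
  assumes mono: "\<forall>k<K. f k \<le> f (Suc k)" and "i \<le> j" and "j \<le> K"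
  shows "f i \<le> f j"
proof -
  obtain d where j: "j = i + d" using \<open>i \<le> j\<close> le_Suc_ex by blast
  have "i + d \<le> K \<Longrightarrow> f i \<le> f (i + d)"
  proof (induction d)
    case (Suc d)
    then have "f i \<le> f (i + d)" and "f (i + d) \<le> f (Suc (i + d))" using mono by auto
    then show ?case by simp
  qed simp
  then show ?thesis using \<open>j \<le> K\<close> unfolding j .
qed

lemma partition_block_exists:
  fixes f :: "nat \<Rightarrow> 'a :: linorder"
  assumes "\<forall>k<K. f k \<le> f (Suc k)" and "f 0 \<le> x" and "x < f K"
  shows "\<exists>k<K. f k \<le> x \<and> x < f (Suc k)"
  using assms
proof (induction K)
  case (Suc K)
  show ?case
  proof (cases "x < f K")
    case True
    then obtain k where "k < K" "f k \<le> x" "x < f (Suc k)" using Suc by auto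
    then show ?thesis using less_SucI by blast
  next
    case False
    then show ?thesis using Suc.prems by auto
  qed
qed simp

lemma block_diagonal_contribution:
  fixes P A :: "'a :: comm_semiring_0 mat" and ofs ob :: "nat \<Rightarrow> nat"
  assumes P: "P \<in> carrier_mat m n" and A: "A \<in> carrier_mat n nb" and yb: "yb \<in> carrier_vec nb"
    and i: "i < m" and k: "k < K"
    and ofs: "ofs 0 = 0" "ofs K = n" "\<forall>k<K. ofs k \<le> ofs (Suc k)"
    and ob: "ob K = nb" "\<forall>k<K. ob k \<le> ob (Suc k)"
    and off_diag: "\<forall>k<K. \<forall>k'<K. k \<noteq> k' \<longrightarrow>
      (\<forall>j \<in> {ofs k..<ofs (Suc k)}. \<forall>l \<in> {ob k'..<ob (Suc k')}. A $$ (j, l) = 0)"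
  shows "let Ak = submatrix A {ofs k..<ofs (Suc k)} {ob k..<ob (Suc k)};
             pik = subvec (row P i) (ofs k) (ofs (Suc k));
             pbik = subvec (row (P * A) i) (ob k) (ob (Suc k));
             ybk = subvec yb (ob k) (ob (Suc k))
         in pbik = transpose_mat Ak *\<^sub>v pik \<and> pik \<bullet> (Ak *\<^sub>v ybk) = pbik \<bullet> ybk"
proof -
  have bounds: "ofs (Suc k) \<le> n" "ob (Suc k) \<le> nb"
    using k ofs ob lift_Suc_mono_le_bounded[of K ofs "Suc k" K] lift_Suc_mono_le_bounded[of K ob "Suc k" K] by auto
  then have Ak: "submatrix A {ofs k..<ofs (Suc k)} {ob k..<ob (Suc k)} \<in>
      carrier_mat (ofs (Suc k) - ofs k) (ob (Suc k) - ob k)"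
    using A by (simp add: submatrix_atLeastLessThan)
  have "subvec (row (P * A) i) (ob k) (ob (Suc k)) =
      transpose_mat (submatrix A {ofs k..<ofs (Suc k)} {ob k..<ob (Suc k)}) *\<^sub>v
        subvec (row P i) (ofs k) (ofs (Suc k))"
  proof (rule subvec_row_mult_block[OF P A i bounds])
    fix r j assume r: "r < n" "r \<notin> {ofs k..<ofs (Suc k)}" and j: "j \<in> {ob k..<ob (Suc k)}"
    obtain k' where k': "k' < K" "r \<in> {ofs k'..<ofs (Suc k')}"
      using partition_block_exists[of K ofs r] ofs r by auto
    moreover have "k' \<noteq> k" using k' r by auto
    ultimately show "A $$ (r, j) = 0" using off_diag k j by blast
  qed
  then show ?thesis
    unfolding Let_def using transpose_vec_mult_scalar[OF Ak] by (simp add: subvec_def)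
qed

theorem mainTheorem2:
  fixes nb m n K :: nat
    and yb :: "real vec" and Xb Vb A :: "real mat"
    and ob ofs :: "nat \<Rightarrow> nat"
  assumes yb: "yb \<in> carrier_vec nb"
    and Xb: "Xb \<in> carrier_mat nb m"
    and Vb: "sym_pos_def nb Vb"
    and A: "A \<in> carrier_mat n nb"
    and A_rank: "full_col_rank A"
  defines "y \<equiv> A *\<^sub>v yb"
    and "X \<equiv> A * Xb"
    and "V \<equiv> A * Vb * transpose_mat A"
    and "Pb \<equiv> pinv (transpose_mat Xb * inv_mat Vb * Xb) * transpose_mat Xb * inv_mat Vb"
    and "P \<equiv> pinv (transpose_mat (A * Xb) * pinv (A * Vb * transpose_mat A) * (A * Xb))
                * transpose_mat (A * Xb) * pinv (A * Vb * transpose_mat A)"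
  shows "P * A = Pb
    \<and> (\<forall>i < m. row Pb i = transpose_mat A *\<^sub>v row P i \<and> row P i \<bullet> y = row Pb i \<bullet> yb)
    \<and> ((ob 0 = 0 \<and> ob K = nb \<and> (\<forall>k < K. ob k \<le> ob (Suc k))
        \<and> ofs 0 = 0 \<and> ofs K = n \<and> (\<forall>k < K. ofs k \<le> ofs (Suc k))
        \<and> (\<forall>k < K. \<forall>k' < K. k \<noteq> k' \<longrightarrow>
              (\<forall>j \<in> {ob k..<ob (Suc k)}. \<forall>l \<in> {ob k'..<ob (Suc k')}. Vb $$ (j, l) = 0))
        \<and> (\<forall>k < K. \<forall>k' < K. k \<noteq> k' \<longrightarrow>
              (\<forall>j \<in> {ofs k..<ofs (Suc k)}. \<forall>l \<in> {ob k'..<ob (Suc k')}. A $$ (j, l) = 0))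
        \<and> (\<forall>k < K. full_col_rank (submatrix A {ofs k..<ofs (Suc k)} {ob k..<ob (Suc k)})))
       \<longrightarrow> (\<forall>k < K. \<forall>i < m.
             (let Ak = submatrix A {ofs k..<ofs (Suc k)} {ob k..<ob (Suc k)};
                  pik = subvec (row P i) (ofs k) (ofs (Suc k));
                  pbik = subvec (row Pb i) (ob k) (ob (Suc k));
                  ybk = subvec yb (ob k) (ob (Suc k))
              in pbik = transpose_mat Ak *\<^sub>v pik \<and> pik \<bullet> (Ak *\<^sub>v ybk) = pbik \<bullet> ybk)))"
proof -
  have Vb_carrier: "Vb \<in> carrier_mat nb nb" using Vb unfolding sym_pos_def_def by simp
  obtain W where W: "W \<in> carrier_mat nb nb" "Vb * W = 1\<^sub>m nb" "W * Vb = 1\<^sub>m nb"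
    using trivial_kernel_imp_inverse[OF Vb_carrier sym_pos_def_imp_trivial_kernel[OF Vb]] by blast
  obtain L where L: "L \<in> carrier_mat nb n" "L * A = 1\<^sub>m nb" "transpose_mat (A * L) = A * L"
    using trivial_kernel_left_inverse[OF A full_col_rank_imp_trivial_kernel[OF A A_rank]] by blast
  have P_gls: "P = gls_projection (A * Xb) (pinv (A * Vb * transpose_mat A))"
    unfolding P_def gls_projection_def ..
  have P: "P \<in> carrier_mat m n"
    unfolding P_gls using A Xb Vb_carrier pinv_carrier_mat[of "A * Vb * transpose_mat A"]
    by (intro gls_projection_carrier_mat) simp_all
  have PA: "P * A = Pb"
    unfolding P_gls pinv_congruence[OF A L Vb_carrier W] Pb_def inv_mat_eqI[OF Vb_carrier W]
    using gls_projection_embedding[OF A Xb L(1,2) W(1)] by (simp add: gls_projection_def)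
  show ?thesis
    unfolding PA[symmetric] y_def
    using row_mult_eq_transpose_mult_vec[OF P A] row_scalar_prod_mult_mat_vec[OF P A yb]
      block_diagonal_contribution[OF P A yb]
    by auto
qed

end
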